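(* Let $1\le N\le100$ and $g>0$. The new shallow water moment model with coefficient matrices $A_G$ in the $x$ direction and $B_G$ in the $y$ direction (defined in the context) is globally hyperbolic: for every state with $h>0$ and arbitrary $u_m,v_m,\alpha_1,\beta_1\in\mathbb{R}$, and for every $\theta\in[0,2\pi)$, the matrix $\cos\theta\,A_G+\sin\theta\,B_G$ is diagonalizable over $\mathbb{R}$.
   Context: The matrices $A_G,B_G\in\mathbb{R}^{(2N+3)\times(2N+3)}$ act on the variables $U=(h,hu_m,hv_m,h\alpha_1,h\beta_1,\dots,h\alpha_N,h\beta_N)^T$, and depend only on $h,u_m,v_m,\alpha_1,\beta_1$ and the constant $g$. Index rows and columns by one scalar index (for $h$) followed by $2\times2$-block indices $0,1,\dots,N$ (block $0$ for $(hu_m,hv_m)$, block $i$ for $(h\alpha_i,h\beta_i)$). All entries not listed are $0$; blocks with index exceeding $N$ are omitted; $I_2$ is the $2\times 2$ identity. $A_G$: scalar row: $0$ in the scalar column, $(1,0)$ in block column $0$. Scalar column: block row $0$: $\left(-u_m^2-\frac{\alpha_1^2}{3}+gh,\ -u_mv_m-\frac{\alpha_1\beta_1}{3}\right)^T$; block row $1$: $\left(-2u_m\alpha_1,\ -(u_m\beta_1+v_m\alpha_1)\right)^T$; block row $2$: $\left(-\frac23\alpha_1^2,\ -\frac23\alpha_1\beta_1\right)^T$. Blocks (block row, block column): $(0,0)$: $\begin{pmatrix} 2u_m & 0 \\ v_m & u_m \end{pmatrix}$; $(i,i)$: $u_mI_2$ for $1\le i\le N$; $(i,i+1)$: $\frac{i+2}{2i+3}\alpha_1I_2$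 for $0\le i\le N-1$; $(1,0)$: $\begin{pmatrix} 2\alpha_1 & 0 \\ \beta_1 & \alpha_1 \end{pmatrix}$; $(i,i-1)$: $\frac{i-1}{2i-1}\alpha_1I_2$ for $2\le i\le N$. $B_G$: scalar row: $0$ in the scalar column, $(0,1)$ in block column $0$. Scalar column: block row $0$: $\left(-u_mv_m-\frac{\alpha_1\beta_1}{3},\ -v_m^2-\frac{\beta_1^2}{3}+gh\right)^T$; block row $1$: $\left(-(u_m\beta_1+v_m\alpha_1),\ -2v_m\beta_1\right)^T$; block row $2$: $\left(-\frac23\alpha_1\beta_1,\ -\frac23\beta_1^2\right)^T$. Blocks: $(0,0)$: $\begin{pmatrix} v_m & u_m \\ 0 & 2v_m \end{pmatrix}$; $(i,i)$: $v_mI_2$ for $1\le i\le N$; $(i,i+1)$: $\frac{i+2}{2i+3}\beta_1I_2$ for $0\le i\le N-1$; $(1,0)$: $\begin{pmatrix} \beta_1 & \alpha_1 \\ 0 & 2\beta_1 \end{pmatrix}$; $(i,i-1)$: $\frac{i-1}{2i-1}\beta_1I_2$ for $2\le i\le N$. *)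

theory Defs
  imports Complex_Main "Jordan_Normal_Form.Matrix"
begin

definition mat22 :: "real \<Rightarrow> real \<Rightarrow> real \<Rightarrow> real \<Rightarrow> real mat" where
  "mat22 a b c d = mat_of_rows_list 2 [[a, b], [c, d]]"

definition vec2 :: "real \<Rightarrow> real \<Rightarrow> real vec" where
  "vec2 a b = vec_of_list [a, b]"

(* The (2N+3) x (2N+3) matrix with one scalar index followed by the 2 x 2 block
   indices 0,...,N. The scalar diagonal entry is 0; R j is the scalar row in block
   column j, C i the scalar column in block row i, and K i j the block (i, j).
   A flat index k > 0 is component (k - 1) mod 2 of block (k - 1) div 2. *)
definition assemble ::
  "nat \<Rightarrow> (nat \<Rightarrow> real vec) \<Rightarrow> (nat \<Rightarrow> real vec) \<Rightarrow> (nat \<Rightarrow> nat \<Rightarrow> real mat) \<Rightarrow> real mat" where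
  "assemble N R C K = mat (2 * N + 3) (2 * N + 3) (\<lambda>(k, l).
     if k = 0 \<and> l = 0 then 0
     else if k = 0 then R ((l - 1) div 2) $ ((l - 1) mod 2)
     else if l = 0 then C ((k - 1) div 2) $ ((k - 1) mod 2)
     else K ((k - 1) div 2) ((l - 1) div 2) $$ ((k - 1) mod 2, (l - 1) mod 2))"

(* u, v, a, b stand for u_m, v_m, alpha_1, beta_1. *)

definition A_G :: "nat \<Rightarrow> real \<Rightarrow> real \<Rightarrow> real \<Rightarrow> real \<Rightarrow> real \<Rightarrow> real \<Rightarrow> real mat" where
  "A_G N g h u v a b = assemble N
     (\<lambda>j. if j = 0 then vec2 1 0 else 0\<^sub>v 2)
     (\<lambda>i. if i = 0 then vec2 (- u\<^sup>2 - a\<^sup>2 / 3 + g * h) (- u * v - a * b / 3)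
          else if i = 1 then vec2 (- 2 * u * a) (- (u * b + v * a))
          else if i = 2 then vec2 (- (2 / 3) * a\<^sup>2) (- (2 / 3) * a * b)
          else 0\<^sub>v 2)
     (\<lambda>i j. if i = 0 \<and> j = 0 then mat22 (2 * u) 0 v u
          else if i = j then u \<cdot>\<^sub>m 1\<^sub>m 2
          else if j = i + 1 then ((real i + 2) / (2 * real i + 3) * a) \<cdot>\<^sub>m 1\<^sub>m 2
          else if i = 1 \<and> j = 0 then mat22 (2 * a) 0 b a
          else if i = j + 1 then ((real i - 1) / (2 * real i - 1) * a) \<cdot>\<^sub>m 1\<^sub>m 2
          else 0\<^sub>m 2 2)"

definition B_G :: "nat \<Rightarrow> real \<Rightarrow> real \<Rightarrow> real \<Rightarrow> real \<Rightarrow> real \<Rightarrow> real \<Rightarrow> real mat" where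
  "B_G N g h u v a b = assemble N
     (\<lambda>j. if j = 0 then vec2 0 1 else 0\<^sub>v 2)
     (\<lambda>i. if i = 0 then vec2 (- u * v - a * b / 3) (- v\<^sup>2 - b\<^sup>2 / 3 + g * h)
          else if i = 1 then vec2 (- (u * b + v * a)) (- 2 * v * b)
          else if i = 2 then vec2 (- (2 / 3) * a * b) (- (2 / 3) * b\<^sup>2)
          else 0\<^sub>v 2)
     (\<lambda>i j. if i = 0 \<and> j = 0 then mat22 v u 0 (2 * v)
          else if i = j then v \<cdot>\<^sub>m 1\<^sub>m 2
          else if j = i + 1 then ((real i + 2) / (2 * real i + 3) * b) \<cdot>\<^sub>m 1\<^sub>m 2
          else if i = 1 \<and> j = 0 then mat22 b a 0 (2 * b)
          else if i = j + 1 then ((real i - 1) / (2 * real i - 1) * b) \<cdot>\<^sub>m 1\<^sub>m 2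
          else 0\<^sub>m 2 2)"

(* At type real mat the similarity transformation and the diagonal matrix are real. *)
definition diagonalizable_mat :: "'a::semiring_1 mat \<Rightarrow> bool" where
  "diagonalizable_mat M \<longleftrightarrow> (\<exists>D. diagonal_mat D \<and> similar_mat M D)"

end

(*
  Put n = (cos theta, sin theta), U = n . (u_m, v_m) and alpha = n . (alpha_1, beta_1). In the moments
  along n and orthogonal to n, and in the variables w = n . (h u) - U h, r_1 = n . (h alpha) - 2 alpha h,
  the matrix minus U is block triangular with three diagonal blocks: a 2x2 block with eigenvalues
  +-sqrt(g h + alpha^2), and alpha times two tridiagonal matrices whose characteristic polynomials are,
  up to scaling, the solutions with index N + 1 of the recurrence j y_{j+1} = (2j+1) x y_j - (j+1) y_{j-1}
  starting from (0, 1) and from (1, x). Both solutions are positive at x = 1, so by interlacing they have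
  simple real roots in (-1, 1), and their Casoratian excludes common roots. As sqrt(g h + alpha^2) > |alpha|,
  for alpha <> 0 there are 2N+3 distinct real eigenvalues. For alpha = 0 the matrix minus U has rank two
  and an eigenbasis is explicit.
*)
theory Submission
  imports Defs "Jordan_Normal_Form.Jordan_Normal_Form_Existence"
begin

section \<open>Roots of polynomials with a three-term recurrence\<close>

text \<open>Both sides have degree at most \<open>n\<close>, the same coefficient there, and agree
  at \<open>n\<close> distinct points. The factored form exposes the sign of \<open>p\<close>
  between its roots.\<close>

lemma poly_eq_prod_roots:
  fixes p :: "real poly" and r :: "nat \<Rightarrow> real"
  assumes deg: "degree p = n" and inj: "inj_on r {1..n}"
    and roots: "\<And>i. i \<in> {1..n} \<Longrightarrow> poly p (r i) = 0"
  shows "p = smult (lead_coeff p) (\<Prod>i\<in>{1..n}. [:- r i, 1:])"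
proof -
  define q where "q = smult (lead_coeff p) (\<Prod>i\<in>{1..n}. [:- r i, 1:])"
  have degq: "degree (\<Prod>i\<in>{1..n}. [:- r i, 1:]) = n"
    by (subst degree_prod_eq_sum_degree) auto
  have "lead_coeff (\<Prod>i\<in>{1..n}. [:- r i, 1:]) = 1"
    by (simp add: lead_coeff_prod)
  then have "coeff q n = coeff p n"
    unfolding q_def coeff_smult degq deg by simp
  moreover have "degree q \<le> n"
    using degq by (simp add: q_def)
  moreover have "poly p z = poly q z" if "z \<in> r ` {1..n}" for z
    using that roots by (auto simp: q_def poly_prod simp del: atLeastAtMost_iff)
  ultimately have "p = q"
    using deg inj by (intro poly_eqI_degree_lead_coeff[of _ n _ "r ` {1..n}"]) (auto simp: card_image)
  then show ?thesis
    by (simp add: q_def)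
qed

text \<open>Isolates what the interlacing argument needs, so that it serves two solutions of one
  recurrence. Positivity of \<open>c\<close> drives the interlacing; positivity at 1, together with
  parity, confines the roots to (-1, 1).\<close>

locale three_term =
  fixes p :: "nat \<Rightarrow> real poly" and a c :: "nat \<Rightarrow> real"
  assumes p_0: "p 0 = 1"
    and p_1: "p (Suc 0) = smult (a 0) [:0, 1:]"
    and p_rec: "p (Suc (Suc n)) = smult (a (Suc n)) (pCons 0 (p (Suc n))) - smult (c n) (p n)"
    and a_pos: "a n > 0" and c_pos: "c n > 0"
    and pos_at_1: "poly (p n) 1 > 0"
begin

lemma degree_lead_coeff: "degree (p n) = n \<and> coeff (p n) n > 0"
proof (induction n rule: induct_nat_012)
  case 1
  then show ?case using a_pos[of 0] by (simp add: p_1)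
next
  case (ge2 n)
  let ?q = "smult (a (Suc n)) (pCons 0 (p (Suc n)))"
  have ne: "p (Suc n) \<noteq> 0"
    using ge2 by force
  have dq: "degree ?q = Suc (Suc n)"
    using ge2 ne a_pos[of "Suc n"] by simp
  have lt: "degree (smult (c n) (p n)) < Suc (Suc n)"
    using ge2 by (metis degree_smult_le le_imp_less_Suc less_SucI)
  have "degree (p (Suc (Suc n))) = Suc (Suc n)"
    unfolding p_rec using dq lt degree_add_eq_left[of "- smult (c n) (p n)" ?q] by simp
  moreover have "coeff (p (Suc (Suc n))) (Suc (Suc n)) = a (Suc n) * coeff (p (Suc n)) (Suc n)"
    unfolding p_rec using coeff_eq_0[OF lt] by simp
  moreover have "0 < a (Suc n) * coeff (p (Suc n)) (Suc n)"
    using ge2 a_pos[of "Suc n"] by simp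
  ultimately show ?case by simp
qed (simp add: p_0)

lemma parity: "poly (p n) (- x) = (- 1) ^ n * poly (p n) x"
proof (induction n rule: induct_nat_012)
  case (ge2 n)
  then show ?case by (simp add: p_rec algebra_simps)
qed (simp_all add: p_0 p_1)

text \<open>The points \<open>r 1 < \<dots> < r n\<close> are the roots of \<open>p n\<close>, padded by the endpoints \<open>r 0\<close> and \<open>r (Suc n)\<close>;
  the sign pattern of \<open>p (Suc n)\<close> on them gives its roots by the intermediate value theorem.\<close>
definition separates :: "nat \<Rightarrow> (nat \<Rightarrow> real) \<Rightarrow> bool" where
  "separates n r \<longleftrightarrow> r 0 = - 1 \<and> r (Suc n) = 1 \<and> (\<forall>i\<le>n. r i < r (Suc i)) \<and>
     (\<forall>i\<in>{1..n}. poly (p n) (r i) = 0) \<and>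
     (\<forall>i\<le>Suc n. 0 < (- 1) ^ (Suc n - i) * poly (p (Suc n)) (r i))"

lemma separates_less:
  assumes "separates n r" "i < j" "j \<le> Suc n"
  shows "r i < r j"
proof -
  have "i < j \<Longrightarrow> j \<le> Suc n \<Longrightarrow> r i < r j"
  proof (induction j)
    case (Suc j)
    have "r j < r (Suc j)" using assms(1) Suc.prems by (auto simp: separates_def)
    then show ?case using Suc by (cases "i = j") auto
  qed simp
  then show ?thesis using assms by simp
qed

lemma endpoint_sign:
  "0 < (- 1) ^ n * poly (p n) (- 1)"
  using parity[of n 1] pos_at_1[of n] by (simp add: mult.assoc[symmetric] power_mult_distrib[symmetric])

text \<open>The leading coefficient is positive, and the negative factors \<open>s - r j\<close> are
  exactly those with \<open>j\<close> from \<open>i\<close> to \<open>n\<close>, which are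
  \<open>Suc n - i\<close> many.\<close>

lemma prod_sign:
  assumes sep: "separates n r" and i: "1 \<le> i" "i \<le> Suc n" and s: "r (i - 1) < s" "s < r i"
  shows "0 < (- 1) ^ (Suc n - i) * poly (p n) s"
proof -
  have inj: "inj_on r {1..n}"
    using separates_less[OF sep] by (intro strict_mono_on_imp_inj_on strict_mono_onI) auto
  have "p n = smult (lead_coeff (p n)) (\<Prod>j\<in>{1..n}. [:- r j, 1:])"
    using sep by (intro poly_eq_prod_roots[OF _ inj]) (auto simp: degree_lead_coeff separates_def)
  then have eq: "poly (p n) s = coeff (p n) n * (\<Prod>j\<in>{1..n}. s - r j)"
    using degree_lead_coeff[of n] by (metis (no_types, lifting) poly_smult poly_prod prod.cong
        poly_pCons poly_0 mult_zero_right add_0_right mult_1_right add.commute diff_conv_add_uminus)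
  have split: "{1..n} = {1..<i} \<union> {i..n}"
    using i by auto
  have neg: "(\<Prod>j\<in>{i..n}. s - r j) = (- 1) ^ (Suc n - i) * (\<Prod>j\<in>{i..n}. r j - s)"
  proof -
    have "(\<Prod>j\<in>{i..n}. s - r j) = (\<Prod>j\<in>{i..n}. (- 1) * (r j - s))" by simp
    then show ?thesis by (simp only: prod.distrib prod_constant card_atLeastAtMost)
  qed
  have "0 < (\<Prod>j\<in>{1..<i}. s - r j)"
  proof (rule prod_pos)
    fix j assume j: "j \<in> {1..<i}"
    have "r j \<le> r (i - 1)"
      using separates_less[OF sep, of j "i - 1"] i j by (cases "j = i - 1") force+
    then show "0 < s - r j" using s by simp
  qed
  moreover have "0 < (\<Prod>j\<in>{i..n}. r j - s)"
  proof (rule prod_pos)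
    fix j assume j: "j \<in> {i..n}"
    have "r i \<le> r j"
      using separates_less[OF sep, of i j] i j by (cases "j = i") auto
    then show "0 < r j - s" using s by simp
  qed
  moreover have "(- 1) ^ (Suc n - i) * poly (p n) s =
      coeff (p n) n * ((\<Prod>j\<in>{1..<i}. s - r j) * (\<Prod>j\<in>{i..n}. r j - s))"
    unfolding eq split by (subst prod.union_disjoint) (auto simp: neg power_mult_distrib[symmetric])
  ultimately show ?thesis
    using degree_lead_coeff[of n] by simp
qed

text \<open>The sign pattern in \<open>separates\<close> alternates, so the intermediate value
  theorem applies on each gap.\<close>

lemma root_between:
  assumes "separates n r" "1 \<le> i" "i \<le> Suc n"
  shows "\<exists>s. r (i - 1) < s \<and> s < r i \<and> poly (p (Suc n)) s = 0"
proof -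
  have lt: "r (i - 1) < r i" using separates_less[OF assms(1)] assms by simp
  define x y where "x = poly (p (Suc n)) (r (i - 1))" and "y = poly (p (Suc n)) (r i)"
  have "\<forall>k\<le>Suc n. 0 < (- 1) ^ (Suc n - k) * poly (p (Suc n)) (r k)"
    using assms(1) by (simp add: separates_def)
  then have "0 < (- 1) ^ (Suc n - i) * y" "0 < (- 1) ^ (Suc n - (i - 1)) * x"
    using assms(3) unfolding x_def y_def by (blast, meson diff_le_self le_trans)
  moreover have "Suc n - (i - 1) = Suc (Suc n - i)" using assms by simp
  ultimately have "0 < ((- 1) ^ (Suc n - i) * y) * ((- 1) ^ Suc (Suc n - i) * x)"
    by (metis mult_pos_pos)
  also have "\<dots> = - (x * y)"
    by (simp add: algebra_simps flip: power_mult_distrib)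
  finally have "x * y < 0" by simp
  then show ?thesis
    using poly_IVT[OF lt, of "p (Suc n)"] by (auto simp: x_def y_def)
qed

text \<open>Interlacing by induction: each gap of the padded roots of \<open>p n\<close> holds a
  root of \<open>p (Suc n)\<close>. At such a root the recurrence makes
  \<open>p (Suc (Suc n))\<close> a negative multiple of \<open>p n\<close>, whose sign is known from
  \<open>prod_sign\<close>.\<close>

lemma separates_ex: "\<exists>r. separates n r"
proof (induction n)
  case 0
  show ?case
    by (rule exI[of _ "\<lambda>i. if i = 0 then - 1 else 1"])
      (use a_pos[of 0] in \<open>auto simp: separates_def p_1 le_Suc_eq\<close>)
next
  case (Suc n)
  then obtain r where sep: "separates n r" ..
  define s where "s i = (if i = 0 then - 1 else if i = Suc (Suc n) then 1
    else SOME s. r (i - 1) < s \<and> s < r i \<and> poly (p (Suc n)) s = 0)" for i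
  have s: "r (i - 1) < s i" "s i < r i" "poly (p (Suc n)) (s i) = 0" if "1 \<le> i" "i \<le> Suc n" for i
    using someI_ex[OF root_between[OF sep that]] that by (auto simp: s_def)
  have ends: "r 0 = - 1" "r (Suc n) = 1"
    using sep by (auto simp: separates_def)
  have "s i < s (Suc i)" if "i \<le> Suc n" for i
  proof -
    have "s i \<le> r i" if "i \<le> Suc n"
      using s(2)[of i] that ends by (cases "i = 0") (auto simp: s_def)
    moreover have "r i \<le> s (Suc i)" if "i \<le> Suc n"
      using s(1)[of "Suc i"] that ends by (cases "i = Suc n") (auto simp: s_def)
    \<comment> \<open>The two weak inequalities are never equalities together: the first is one only
      at \<open>i = 0\<close>, the second only at \<open>i = Suc n\<close>.\<close>
    moreover have "s i < r i \<or> r i < s (Suc i)"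
      using s(2)[of i] s(1)[of "Suc i"] that by (cases "i = 0") auto
    ultimately show ?thesis using that by auto
  qed
  moreover have "0 < (- 1) ^ (Suc (Suc n) - i) * poly (p (Suc (Suc n))) (s i)" if i: "i \<le> Suc (Suc n)" for i
  proof -
    consider "i = 0" | "i = Suc (Suc n)" | "1 \<le> i" "i \<le> Suc n" using i by linarith
    then show ?thesis
    proof cases
      case 1
      then show ?thesis using endpoint_sign[of "Suc (Suc n)"] by (simp add: s_def)
    next
      case 2
      then show ?thesis using pos_at_1[of "Suc (Suc n)"] by (simp add: s_def)
    next
      case 3
      have "0 < (- 1) ^ (Suc n - i) * poly (p n) (s i)"
        using prod_sign[OF sep 3 s(1,2)[OF 3]] .
      then have "0 < c n * ((- 1) ^ (Suc n - i) * poly (p n) (s i))"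
        using c_pos by simp
      \<comment> \<open>The middle term of the recurrence vanishes at \<open>s i\<close>, and the
        minus sign before \<open>c n\<close> supplies the extra power of -1.\<close>
      also have "\<dots> = (- 1) ^ (Suc (Suc n) - i) * poly (p (Suc (Suc n))) (s i)"
        using s(3)[OF 3] 3 by (simp add: p_rec Suc_diff_le)
      finally show ?thesis .
    qed
  qed
  ultimately have "separates (Suc n) s"
    unfolding separates_def using s(3) by (auto simp: s_def[of 0] s_def[of "Suc (Suc n)"])
  then show ?case by blast
qed

text \<open>The separating points provide \<open>n\<close> roots strictly between the endpoints, and
  the degree allows no others.\<close>

lemma roots_in_unit_interval:
  "{x. poly (p n) x = 0} \<subseteq> {-1<..<1}" "card {x. poly (p n) x = 0} = n"
proof -
  obtain r where sep: "separates n r" using separates_ex ..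
  have inj: "inj_on r {1..n}"
    using separates_less[OF sep] by (intro strict_mono_on_imp_inj_on strict_mono_onI) auto
  have ne: "p n \<noteq> 0" using degree_lead_coeff[of n] by force
  have sub: "r ` {1..n} \<subseteq> {x. poly (p n) x = 0}"
    using sep by (auto simp: separates_def)
  have "card {x. poly (p n) x = 0} \<le> card (r ` {1..n})"
    using card_poly_roots_bound[OF ne] degree_lead_coeff[of n] by (simp only: card_image[OF inj]) simp
  then have eq: "r ` {1..n} = {x. poly (p n) x = 0}"
    using sub card_seteq[OF poly_roots_finite[OF ne] sub] by simp
  show "card {x. poly (p n) x = 0} = n"
    unfolding eq[symmetric] by (simp only: card_image[OF inj]) simp
  have "- 1 < r i \<and> r i < 1" if "i \<in> {1..n}" for i
    using that separates_less[OF sep, of 0 i] separates_less[OF sep, of i "Suc n"] sep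
    by (auto simp: separates_def)
  then show "{x. poly (p n) x = 0} \<subseteq> {-1<..<1}"
    unfolding eq[symmetric] by auto
qed

end

section \<open>Criteria for diagonalizability\<close>

text \<open>Used to bound the sizes of Jordan blocks by 1.\<close>

lemma order_prod_distinct_linear_le:
  fixes as :: "real list"
  assumes "distinct as"
  shows "order x (\<Prod>a\<leftarrow>as. [:- a, 1:]) \<le> 1"
  using assms
proof (induction as)
  case (Cons a as)
  have ne: "(\<Prod>a\<leftarrow>as. [:- a, 1:]) \<noteq> 0"
    by (auto simp: prod_list_zero_iff)
  have root: "poly (\<Prod>a\<leftarrow>bs. [:- a, 1:]) x = (\<Prod>a\<leftarrow>bs. x - a)" for bs
    by (induction bs) (auto simp: algebra_simps)
  have *: "order x (\<Prod>a\<leftarrow>a # as. [:- a, 1:]) = order x [:- a, 1:] + order x (\<Prod>a\<leftarrow>as. [:- a, 1:])"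
    using ne by (simp add: order_mult del: mult_pCons_left)
  show ?case
  proof (cases "x = a")
    case True
    then have "poly (\<Prod>a\<leftarrow>as. [:- a, 1:]) x \<noteq> 0"
      using Cons.prems unfolding root by (auto simp: prod_list_zero_iff)
    then have "order x (\<Prod>a\<leftarrow>as. [:- a, 1:]) = 0"
      by (rule order_0I)
    moreover have "order x [:- a, 1:] \<le> 1"
      using order_degree[of "[:- a, 1:]" x] by simp
    ultimately show ?thesis unfolding * by simp
  next
    case False
    then have "order x [:- a, 1:] = 0" by (intro order_0I) auto
    then show ?thesis unfolding * using Cons by simp
  qed
qed simp

lemma diagonal_jordan_matrix:
  assumes "\<forall>(m, a) \<in> set n_as. m = 1"
  shows "diagonal_mat (jordan_matrix n_as)"
  using assms
proof (induction n_as)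
  case (Cons x n_as)
  obtain a where x: "x = (1, a)" using Cons.prems by (cases x) auto
  have IH: "diagonal_mat (jordan_matrix n_as)" using Cons by auto
  let ?m = "sum_list (map fst n_as)"
  have "jordan_matrix (x # n_as) =
      four_block_mat (jordan_block 1 a) (0\<^sub>m 1 ?m) (0\<^sub>m ?m 1) (jordan_matrix n_as)"
    using jordan_matrix_dim[of n_as] by (simp add: jordan_matrix_def x Let_def)
  then show ?case
    using IH by (auto simp: diagonal_mat_def four_block_mat_def Let_def)
qed (simp add: jordan_matrix_def diagonal_mat_def)

text \<open>The characteristic polynomial splits into distinct linear factors, so a real Jordan form
  exists, and the order of each root bounds its block sizes. Only roots are required, so some
  eigenvalues may be found from right and others from left eigenvectors.\<close>

lemma diagonalizable_mat_distinct_roots: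
  fixes M :: "real mat"
  assumes M: "M \<in> carrier_mat n n" and fin: "finite S" and card: "card S = n"
    and roots: "\<And>x. x \<in> S \<Longrightarrow> poly (char_poly M) x = 0"
  shows "diagonalizable_mat M"
proof -
  define as where "as = sorted_list_of_set S"
  have as: "distinct as" "set as = S" "length as = n"
    using fin card by (auto simp: as_def)
  have deg: "degree (\<Prod>a\<leftarrow>as. [:- a, 1:]) = n"
    using degree_linear_factors[of uminus as] as by simp
  have monic: "monic (\<Prod>a\<leftarrow>as. [:- a, 1:])"
    by (rule monic_prod_list) auto
  have "char_poly M = (\<Prod>a\<leftarrow>as. [:- a, 1:])"
  proof (rule poly_eqI_degree_lead_coeff[of _ n _ S])
    show "coeff (char_poly M) n = coeff (\<Prod>a\<leftarrow>as. [:- a, 1:]) n"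
      using degree_monic_char_poly[OF M] deg monic by metis
    fix z assume z: "z \<in> S"
    then have "poly (\<Prod>a\<leftarrow>as. [:- a, 1:]) z = 0"
      by (auto simp: poly_prod_list prod_list_zero_iff o_def as(2))
    then show "poly (char_poly M) z = poly (\<Prod>a\<leftarrow>as. [:- a, 1:]) z"
      using roots z by simp
  qed (use degree_monic_char_poly[OF M] deg card in auto)
  then obtain n_as where jnf: "jordan_nf M n_as"
    and cp: "char_poly M = (\<Prod>a\<leftarrow>as. [:- a, 1:])"
    using jordan_nf_exists[OF M] by blast
  have "\<forall>(m, a) \<in> set n_as. m = 1"
  proof safe
    fix m a assume ma: "(m, a) \<in> set n_as"
    have "m \<le> 1"
      using jordan_nf_block_size_order_bound[OF jnf ma] order_prod_distinct_linear_le[OF as(1), of a]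
      unfolding cp by simp
    moreover have "m \<noteq> 0" using jnf ma by (force simp: jordan_nf_def)
    ultimately show "m = 1" by simp
  qed
  then show ?thesis
    using jnf diagonal_jordan_matrix unfolding diagonalizable_mat_def jordan_nf_def by blast
qed

text \<open>Covers repeated eigenvalues. With the vectors \<open>y k\<close> as rows of
  \<open>Q\<close>, the eigenvector equations read \<open>Q * M = D * Q\<close>, and
  \<open>indep\<close> says that \<open>Q\<close> has trivial kernel, hence is invertible.\<close>

lemma diagonalizable_mat_left_eigenbasis:
  fixes M :: "real mat"
  assumes M: "M \<in> carrier_mat n n"
    and y: "\<And>k. k < n \<Longrightarrow> y k \<in> carrier_vec n"
    and ev: "\<And>k. k < n \<Longrightarrow> transpose_mat M *\<^sub>v y k = d k \<cdot>\<^sub>v y k"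
    and indep: "\<And>v. v \<in> carrier_vec n \<Longrightarrow> (\<And>k. k < n \<Longrightarrow> y k \<bullet> v = 0) \<Longrightarrow> v = 0\<^sub>v n"
  shows "diagonalizable_mat M"
proof -
  define Q where "Q = mat n n (\<lambda>(k, l). y k $ l)"
  define D where "D = mat n n (\<lambda>(k, l). if k = l then d k else 0)"
  have Q: "Q \<in> carrier_mat n n" and D: "D \<in> carrier_mat n n"
    by (simp_all add: Q_def D_def)
  have row: "row Q k = y k" if "k < n" for k
    using that y[OF that] by (intro eq_vecI) (auto simp: Q_def)
  have "det Q \<noteq> 0"
  proof
    assume "det Q = 0"
    then obtain v where v: "v \<in> carrier_vec n" "v \<noteq> 0\<^sub>v n" "Q *\<^sub>v v = 0\<^sub>v n"
      using det_0_iff_vec_prod_zero_field[OF Q] by auto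
    have "y k \<bullet> v = 0" if "k < n" for k
      using arg_cong[OF v(3), of "\<lambda>w. w $ k"] that row[OF that] Q by simp
    then show False using indep[OF v(1)] v(2) by blast
  qed
  then obtain P where P: "P \<in> carrier_mat n n" "P * Q = 1\<^sub>m n" "Q * P = 1\<^sub>m n"
    using det_non_zero_imp_unit[OF Q, of "()"] by (auto simp: Units_def ring_mat_def)
  have QM: "Q * M = D * Q"
  proof (rule eq_matI)
    fix k l assume "k < dim_row (D * Q)" "l < dim_col (D * Q)"
    then have kl: "k < n" "l < n" using Q D by auto
    have "(Q * M) $$ (k, l) = (transpose_mat M *\<^sub>v y k) $ l"
      using kl Q M y[OF kl(1)] by (simp add: row comm_scalar_prod[of _ n])
    also have "\<dots> = d k * y k $ l"
      using kl y[OF kl(1)] by (simp add: ev)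
    also have "\<dots> = (\<Sum>i = 0..<n. (if k = i then d k else 0) * y i $ l)"
      using kl by (simp add: if_distrib[of "\<lambda>x. x * _"] cong: if_cong)
    also have "\<dots> = (D * Q) $$ (k, l)"
      using kl by (simp add: D_def Q_def scalar_prod_def)
    finally show "(Q * M) $$ (k, l) = (D * Q) $$ (k, l)" .
  qed (use Q D M in auto)
  have "M = P * (Q * M)"
    using P Q M by (simp flip: assoc_mult_mat[of P n n Q n M n])
  also have "\<dots> = P * D * Q"
    unfolding QM using P Q D by simp
  finally have "similar_mat M D"
    using P Q D M by (intro similar_matI[of _ _ P Q n]) auto
  then show ?thesis
    unfolding diagonalizable_mat_def by (auto simp: D_def diagonal_mat_def intro!: exI[of _ D])
qed

section \<open>The Legendre-type recurrence\<close>

text \<open>The recurrence satisfied by the derivatives \<open>P'\<^sub>n\<close> of the Legendre polynomials.\<close>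
fun legendre_rec :: "real poly \<Rightarrow> real poly \<Rightarrow> nat \<Rightarrow> real poly" where
  "legendre_rec p q 0 = p"
| "legendre_rec p q (Suc 0) = q"
| "legendre_rec p q (Suc (Suc n)) =
     smult ((2 * real n + 3) / (real n + 1)) (pCons 0 (legendre_rec p q (Suc n)))
     - smult ((real n + 2) / (real n + 1)) (legendre_rec p q n)"

text \<open>\<open>leg1 n\<close> is \<open>P'\<^sub>n\<close>; the solution \<open>leg0\<close> has the constant value 1 at \<open>x = 1\<close>, so its roots
  stay inside the open unit interval.\<close>
abbreviation leg0 :: "nat \<Rightarrow> real poly" where "leg0 \<equiv> legendre_rec 1 [:0, 1:]"
abbreviation leg1 :: "nat \<Rightarrow> real poly" where "leg1 \<equiv> legendre_rec 0 1"

lemma poly_legendre_rec: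
  "(real n + 1) * poly (legendre_rec p q (Suc (Suc n))) x
     = (2 * real n + 3) * (x * poly (legendre_rec p q (Suc n)) x) - (real n + 2) * poly (legendre_rec p q n) x"
proof -
  have "real n + 1 \<noteq> 0" by linarith
  then have "(real n + 1) * (c / (real n + 1) * y) = c * y" for c y :: real by simp
  then show ?thesis by (simp only: legendre_rec.simps poly_diff poly_smult poly_pCons right_diff_distrib add_0)
qed

lemma poly_leg0_1: "poly (leg0 n) 1 = 1"
proof (induction n rule: induct_nat_012)
  case (ge2 n)
  have "(real n + 1) * poly (leg0 (Suc (Suc n))) 1 = (real n + 1) * 1"
    unfolding poly_legendre_rec ge2 by simp
  moreover have "real n + 1 \<noteq> 0" by linarith
  ultimately show ?case by (metis mult_left_cancel)
qed simp_all

lemma poly_leg1_1: "poly (leg1 n) 1 = real n * (real n + 1) / 2"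
proof (induction n rule: induct_nat_012)
  case (ge2 n)
  have "(real n + 1) * poly (leg1 (Suc (Suc n))) 1
      = (real n + 1) * (real (Suc (Suc n)) * (real (Suc (Suc n)) + 1) / 2)"
    unfolding poly_legendre_rec ge2 by (simp add: field_simps)
  moreover have "real n + 1 \<noteq> 0" by linarith
  ultimately show ?case by (metis mult_left_cancel)
qed simp_all

text \<open>The coefficient at 0 is separate because it belongs to the starting polynomial
  \<open>x\<close>, not to a step of the recurrence.\<close>

interpretation leg0: three_term leg0
  "\<lambda>n. if n = 0 then 1 else (2 * real n + 1) / real n" "\<lambda>n. (real n + 2) / (real n + 1)"
  by unfold_locales (auto simp: poly_leg0_1 add.commute add_pos_nonneg)

text \<open>The shift skips the zero polynomial \<open>leg1 0\<close>; thus
  \<open>leg1 (Suc N)\<close> has degree \<open>N\<close>.\<close>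

interpretation leg1: three_term "\<lambda>n. leg1 (Suc n)"
  "\<lambda>n. (2 * real n + 3) / (real n + 1)" "\<lambda>n. (real n + 3) / (real n + 2)"
  by unfold_locales (auto simp: poly_leg1_1 add.commute add_pos_nonneg)

text \<open>A discrete Wronskian: the terms with \<open>x\<close> cancel, each step multiplies by
  (n+2)/(n+1), and the product telescopes. The value is independent of \<open>x\<close> and never
  zero, which excludes common roots.\<close>

lemma casoratian:
  "poly (leg0 n) x * poly (leg1 (Suc n)) x - poly (leg0 (Suc n)) x * poly (leg1 n) x = real n + 1"
proof (induction n)
  case (Suc n)
  let ?r = "\<lambda>k. poly (leg0 k) x" and ?s = "\<lambda>k. poly (leg1 k) x"
  have "?r (Suc n) * ?s (Suc (Suc n)) - ?r (Suc (Suc n)) * ?s (Suc n)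
      = (real n + 2) / (real n + 1) * (?r n * ?s (Suc n) - ?r (Suc n) * ?s n)"
    by (simp add: algebra_simps)
  then show ?case unfolding Suc by simp
qed simp

lemma no_common_root: "poly (leg0 n) x = 0 \<Longrightarrow> poly (leg1 n) x \<noteq> 0"
  using casoratian[of n x] by auto

section \<open>Matrices in block form\<close>

text \<open>\<open>X\<close> and \<open>Y\<close> are the first and second components of the blocks.
  They are total functions, so a row may refer to index \<open>N + 1\<close>; only values up to
  \<open>N\<close> enter the vector.\<close>

definition blockvec :: "nat \<Rightarrow> real \<Rightarrow> (nat \<Rightarrow> real) \<Rightarrow> (nat \<Rightarrow> real) \<Rightarrow> real vec" where
  "blockvec N s X Y = vec (2 * N + 3) (\<lambda>k. if k = 0 then s
     else if (k - 1) mod 2 = 0 then X ((k - 1) div 2) else Y ((k - 1) div 2))"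

lemma blockvec_carrier [simp]: "blockvec N s X Y \<in> carrier_vec (2 * N + 3)"
  and dim_blockvec [simp]: "dim_vec (blockvec N s X Y) = 2 * N + 3"
  by (simp_all add: blockvec_def)

lemma blockvec_index [simp]:
  "blockvec N s X Y $ 0 = s"
  "j \<le> N \<Longrightarrow> blockvec N s X Y $ (Suc (2 * j)) = X j"
  "j \<le> N \<Longrightarrow> blockvec N s X Y $ (Suc (Suc (2 * j))) = Y j"
  by (auto simp: blockvec_def)

lemma block_index_cases:
  fixes k N :: nat
  assumes "k < 2 * N + 3"
  obtains "k = 0" | j where "j \<le> N" "k = Suc (2 * j)" | j where "j \<le> N" "k = Suc (Suc (2 * j))"
  using assms by (cases k; cases "even k") (auto elim!: evenE oddE)

lemma eq_blockvecI:
  assumes "v \<in> carrier_vec (2 * N + 3)" "v $ 0 = s"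
    and "\<And>j. j \<le> N \<Longrightarrow> v $ (Suc (2 * j)) = X j" "\<And>j. j \<le> N \<Longrightarrow> v $ (Suc (Suc (2 * j))) = Y j"
  shows "v = blockvec N s X Y"
proof (rule eq_vecI)
  fix k assume "k < dim_vec (blockvec N s X Y)"
  then have "k < 2 * N + 3" by simp
  then show "v $ k = blockvec N s X Y $ k"
    by (cases rule: block_index_cases) (use assms in \<open>simp_all del: add_2_eq_Suc'\<close>)
qed (use assms in auto)

lemma sum_blocks:
  fixes f :: "nat \<Rightarrow> real"
  shows "(\<Sum>k = 0..<2 * N + 3. f k) = f 0 + (\<Sum>j\<le>N. f (Suc (2 * j)) + f (Suc (Suc (2 * j))))"
  by (induction N) (simp_all add: numeral_eq_Suc)

lemma blockvec_scalar_prod: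
  assumes "v \<in> carrier_vec (2 * N + 3)"
  shows "blockvec N s X Y \<bullet> v = s * v $ 0 + (\<Sum>j\<le>N. X j * v $ (Suc (2 * j)) + Y j * v $ (Suc (Suc (2 * j))))"
  using assms unfolding scalar_prod_def
  by (simp only: carrier_vecD sum_blocks blockvec_index) simp

section \<open>Products of assembled matrices with block vectors\<close>

lemma assemble_carrier [simp]: "assemble N R C K \<in> carrier_mat (2 * N + 3) (2 * N + 3)"
  by (simp add: assemble_def)

lemma assemble_index_0 [simp]: "assemble N R C K $$ (0, 0) = 0"
  by (simp add: assemble_def)

lemma assemble_index [simp]:
  assumes "i \<le> N" "j \<le> N"
  shows "assemble N R C K $$ (0, Suc (2 * j)) = R j $ 0" "assemble N R C K $$ (0, Suc (Suc (2 * j))) = R j $ 1"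
    "assemble N R C K $$ (Suc (2 * i), 0) = C i $ 0" "assemble N R C K $$ (Suc (Suc (2 * i)), 0) = C i $ 1"
    "assemble N R C K $$ (Suc (2 * i), Suc (2 * j)) = K i j $$ (0, 0)"
    "assemble N R C K $$ (Suc (2 * i), Suc (Suc (2 * j))) = K i j $$ (0, 1)"
    "assemble N R C K $$ (Suc (Suc (2 * i)), Suc (2 * j)) = K i j $$ (1, 0)"
    "assemble N R C K $$ (Suc (Suc (2 * i)), Suc (Suc (2 * j))) = K i j $$ (1, 1)"
  using assms by (auto simp: assemble_def)

lemma mult_mat_blockvec:
  assumes "M \<in> carrier_mat (2 * N + 3) (2 * N + 3)"
  shows "M *\<^sub>v blockvec N s X Y = blockvec N
    (M $$ (0, 0) * s + (\<Sum>j\<le>N. M $$ (0, Suc (2 * j)) * X j + M $$ (0, Suc (Suc (2 * j))) * Y j))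
    (\<lambda>i. M $$ (Suc (2 * i), 0) * s + (\<Sum>j\<le>N. M $$ (Suc (2 * i), Suc (2 * j)) * X j + M $$ (Suc (2 * i), Suc (Suc (2 * j))) * Y j))
    (\<lambda>i. M $$ (Suc (Suc (2 * i)), 0) * s + (\<Sum>j\<le>N. M $$ (Suc (Suc (2 * i)), Suc (2 * j)) * X j + M $$ (Suc (Suc (2 * i)), Suc (Suc (2 * j))) * Y j))"
proof -
  have "(M *\<^sub>v blockvec N s X Y) $ k =
      M $$ (k, 0) * s + (\<Sum>j\<le>N. M $$ (k, Suc (2 * j)) * X j + M $$ (k, Suc (Suc (2 * j))) * Y j)"
    if k: "k < 2 * N + 3" for k
  proof -
    have "(M *\<^sub>v blockvec N s X Y) $ k = blockvec N s X Y \<bullet> row M k"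
      using assms k by (simp add: comm_scalar_prod[of _ "2 * N + 3"])
    also have "\<dots> = s * row M k $ 0 + (\<Sum>j\<le>N. X j * row M k $ (Suc (2 * j)) + Y j * row M k $ (Suc (Suc (2 * j))))"
      using assms by (intro blockvec_scalar_prod) (simp add: carrier_vecI)
    also have "\<dots> = M $$ (k, 0) * s + (\<Sum>j\<le>N. M $$ (k, Suc (2 * j)) * X j + M $$ (k, Suc (Suc (2 * j))) * Y j)"
      using assms k by (intro arg_cong2[where f = "(+)"] sum.cong) (auto simp: mult.commute)
    finally show ?thesis .
  qed
  then show ?thesis
    using assms by (intro eq_blockvecI) auto
qed

lemma assemble_mult_blockvec:
  "assemble N R C K *\<^sub>v blockvec N s X Y = blockvec N
    (\<Sum>j\<le>N. R j $ 0 * X j + R j $ 1 * Y j)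
    (\<lambda>i. C i $ 0 * s + (\<Sum>j\<le>N. K i j $$ (0, 0) * X j + K i j $$ (0, 1) * Y j))
    (\<lambda>i. C i $ 1 * s + (\<Sum>j\<le>N. K i j $$ (1, 0) * X j + K i j $$ (1, 1) * Y j))"
  unfolding mult_mat_blockvec[OF assemble_carrier]
  by (rule eq_blockvecI) (simp_all)

lemma transpose_assemble_mult_blockvec:
  "transpose_mat (assemble N R C K) *\<^sub>v blockvec N s X Y = blockvec N
    (\<Sum>i\<le>N. C i $ 0 * X i + C i $ 1 * Y i)
    (\<lambda>j. R j $ 0 * s + (\<Sum>i\<le>N. K i j $$ (0, 0) * X i + K i j $$ (1, 0) * Y i))
    (\<lambda>j. R j $ 1 * s + (\<Sum>i\<le>N. K i j $$ (0, 1) * X i + K i j $$ (1, 1) * Y i))"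
proof -
  have idx: "transpose_mat (assemble N R C K) $$ (k, l) = assemble N R C K $$ (l, k)"
    if "k < 2 * N + 3" "l < 2 * N + 3" for k l
    using that assemble_carrier[of N R C K] by (intro index_transpose_mat) (auto simp: assemble_def)
  show ?thesis
    unfolding mult_mat_blockvec[OF transpose_carrier_mat[THEN iffD2, OF assemble_carrier]]
    by (rule eq_blockvecI) (simp_all add: idx del: index_transpose_mat)
qed

text \<open>The condition at \<open>Suc N\<close> is the closing condition of the recurrence; it
  lets the last row \<open>i = N\<close> be treated like the others.\<close>

lemma sum_tridiagonal:
  fixes f :: "nat \<Rightarrow> real"
  assumes "i \<le> N" "\<And>j. j + 1 < i \<or> i + 1 < j \<Longrightarrow> f j = 0" "f (Suc N) = 0"
  shows "(\<Sum>j\<le>N. f j) = (if i = 0 then 0 else f (i - 1)) + f i + f (Suc i)"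
proof -
  \<comment> \<open>The added zero term makes the window from \<open>i - 1\<close> to
    \<open>Suc i\<close> fit into the range even for \<open>i = N\<close>; at \<open>i = 0\<close>
    truncated subtraction leaves only 0 and 1.\<close>
  have "(\<Sum>j\<le>N. f j) = (\<Sum>j\<le>Suc N. f j)" using assms(3) by simp
  also have "\<dots> = (\<Sum>j\<in>{i - 1..Suc i}. f j)"
  proof (rule sum.mono_neutral_right)
    show "\<forall>j\<in>{..Suc N} - {i - 1..Suc i}. f j = 0"
    proof
      fix j assume "j \<in> {..Suc N} - {i - 1..Suc i}"
      then have "j + 1 < i \<or> i + 1 < j" by auto
      then show "f j = 0" by (rule assms(2))
    qed
  qed (use assms in auto)
  also have "\<dots> = (if i = 0 then 0 else f (i - 1)) + f i + f (Suc i)"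
    by (cases i) (auto simp: numeral_eq_Suc)
  finally show ?thesis .
qed

section \<open>The coefficient matrices and their transposes acting on block vectors\<close>

lemma blockvec_cong:
  assumes "s = s'" "\<And>j. j \<le> N \<Longrightarrow> X j = X' j" "\<And>j. j \<le> N \<Longrightarrow> Y j = Y' j"
  shows "blockvec N s X Y = blockvec N s' X' Y'"
  using assms by (intro eq_blockvecI) auto

lemma vec2_index [simp]: "vec2 x y $ 0 = x" "vec2 x y $ Suc 0 = y"
  by (simp_all add: vec2_def)

lemma mat22_index [simp]:
  "mat22 x y z w $$ (0, 0) = x" "mat22 x y z w $$ (0, Suc 0) = y"
  "mat22 x y z w $$ (Suc 0, 0) = z" "mat22 x y z w $$ (Suc 0, Suc 0) = w"
  by (simp_all add: mat22_def mat_of_rows_list_def)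

lemma add_blockvec:
  "blockvec N s X Y + blockvec N s' X' Y' =
     blockvec N (s + s') (\<lambda>i. X i + X' i) (\<lambda>i. Y i + Y' i)"
  by (rule eq_blockvecI) (auto intro!: add_carrier_vec)

lemma smult_blockvec:
  "c \<cdot>\<^sub>v blockvec N s X Y = blockvec N (c * s) (\<lambda>i. c * X i) (\<lambda>i. c * Y i)"
  by (rule eq_blockvecI) auto

text \<open>The scalar component is 0 because the right eigenvectors in use have no \<open>h\<close>
  component, so the scalar column never contributes.\<close>

lemma A_G_mult_blockvec:
  assumes "X (Suc N) = 0" "Y (Suc N) = 0"
  shows "A_G N g h u v a b *\<^sub>v blockvec N 0 X Y = blockvec N (X 0)
    (\<lambda>i. if i = 0 then 2 * u * X 0 + 2 / 3 * a * X 1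
      else if i = 1 then 2 * a * X 0 + u * X 1 + 3 / 5 * a * X 2
      else (real i - 1) / (2 * real i - 1) * a * X (i - 1) + u * X i + (real i + 2) / (2 * real i + 3) * a * X (Suc i))
    (\<lambda>i. if i = 0 then v * X 0 + u * Y 0 + 2 / 3 * a * Y 1
      else if i = 1 then b * X 0 + a * Y 0 + u * Y 1 + 3 / 5 * a * Y 2
      else (real i - 1) / (2 * real i - 1) * a * Y (i - 1) + u * Y i + (real i + 2) / (2 * real i + 3) * a * Y (Suc i))"
  unfolding A_G_def assemble_mult_blockvec
proof (rule blockvec_cong, goal_cases)
  case 1
  show ?case using assms by (subst sum_tridiagonal[where i = 0]) auto
next
  case (2 i)
  then show ?case using assms by (subst sum_tridiagonal[where i = i]) (auto simp: numeral_2_eq_2)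
next
  case (3 i)
  then show ?case using assms by (subst sum_tridiagonal[where i = i]) (auto simp: numeral_2_eq_2)
qed

lemma B_G_mult_blockvec:
  assumes "X (Suc N) = 0" "Y (Suc N) = 0"
  shows "B_G N g h u v a b *\<^sub>v blockvec N 0 X Y = blockvec N (Y 0)
    (\<lambda>i. if i = 0 then v * X 0 + u * Y 0 + 2 / 3 * b * X 1
      else if i = 1 then b * X 0 + a * Y 0 + v * X 1 + 3 / 5 * b * X 2
      else (real i - 1) / (2 * real i - 1) * b * X (i - 1) + v * X i + (real i + 2) / (2 * real i + 3) * b * X (Suc i))
    (\<lambda>i. if i = 0 then 2 * v * Y 0 + 2 / 3 * b * Y 1
      else if i = 1 then 2 * b * Y 0 + v * Y 1 + 3 / 5 * b * Y 2
      else (real i - 1) / (2 * real i - 1) * b * Y (i - 1) + v * Y i + (real i + 2) / (2 * real i + 3) * b * Y (Suc i))"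
  unfolding B_G_def assemble_mult_blockvec
proof (rule blockvec_cong, goal_cases)
  case 1
  show ?case using assms by (subst sum_tridiagonal[where i = 0]) auto
next
  case (2 i)
  then show ?case using assms by (subst sum_tridiagonal[where i = i]) (auto simp: numeral_2_eq_2)
next
  case (3 i)
  then show ?case using assms by (subst sum_tridiagonal[where i = i]) (auto simp: numeral_2_eq_2)
qed

text \<open>The scalar columns are supported on block rows 0, 1 and 2. For \<open>N = 1\<close> row
  2 is absent, and the condition at \<open>Suc N\<close> makes \<open>f 2\<close> vanish.\<close>

lemma sum_first_three:
  fixes f :: "nat \<Rightarrow> real"
  assumes "1 \<le> N" "\<And>j. 2 < j \<Longrightarrow> f j = 0" "f (Suc N) = 0"
  shows "(\<Sum>j\<le>N. f j) = f 0 + f 1 + f 2"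
  using assms by (subst sum_tridiagonal[where i = 1]) (auto simp: numeral_2_eq_2)

text \<open>After transposition the couplings are (j+1)/(2j+1) and j/(2j+1) uniformly for
  \<open>j\<close> at least 1, those of the Legendre recurrence; only block column 0 remains
  exceptional.\<close>

lemma transpose_A_G_mult_blockvec:
  assumes "1 \<le> N" "X (Suc N) = 0" "Y (Suc N) = 0"
  shows "transpose_mat (A_G N g h u v a b) *\<^sub>v blockvec N s X Y = blockvec N
    ((- u\<^sup>2 - a\<^sup>2 / 3 + g * h) * X 0 + (- u * v - a * b / 3) * Y 0
      - 2 * u * a * X 1 - (u * b + v * a) * Y 1 - 2 / 3 * a\<^sup>2 * X 2 - 2 / 3 * a * b * Y 2)
    (\<lambda>j. if j = 0 then s + 2 * u * X 0 + v * Y 0 + 2 * a * X 1 + b * Y 1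
      else (real j + 1) / (2 * real j + 1) * a * X (j - 1) + u * X j + real j / (2 * real j + 1) * a * X (Suc j))
    (\<lambda>j. if j = 0 then u * Y 0 + a * Y 1
      else (real j + 1) / (2 * real j + 1) * a * Y (j - 1) + u * Y j + real j / (2 * real j + 1) * a * Y (Suc j))"
  unfolding A_G_def transpose_assemble_mult_blockvec
proof (rule blockvec_cong, goal_cases)
  case 1
  show ?case using assms by (subst sum_first_three) (auto simp: algebra_simps)
next
  case (2 i)
  then show ?case using assms by (subst sum_tridiagonal[where i = i]) (auto simp: of_nat_diff add.commute)
next
  case (3 i)
  then show ?case using assms by (subst sum_tridiagonal[where i = i]) (auto simp: of_nat_diff add.commute)
qed

lemma transpose_B_G_mult_blockvec:
  assumes "1 \<le> N" "X (Suc N) = 0" "Y (Suc N) = 0"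
  shows "transpose_mat (B_G N g h u v a b) *\<^sub>v blockvec N s X Y = blockvec N
    ((- u * v - a * b / 3) * X 0 + (- v\<^sup>2 - b\<^sup>2 / 3 + g * h) * Y 0
      - (u * b + v * a) * X 1 - 2 * v * b * Y 1 - 2 / 3 * a * b * X 2 - 2 / 3 * b\<^sup>2 * Y 2)
    (\<lambda>j. if j = 0 then v * X 0 + b * X 1
      else (real j + 1) / (2 * real j + 1) * b * X (j - 1) + v * X j + real j / (2 * real j + 1) * b * X (Suc j))
    (\<lambda>j. if j = 0 then s + u * X 0 + 2 * v * Y 0 + a * X 1 + 2 * b * Y 1
      else (real j + 1) / (2 * real j + 1) * b * Y (j - 1) + v * Y j + real j / (2 * real j + 1) * b * Y (Suc j))"
  unfolding B_G_def transpose_assemble_mult_blockvec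
proof (rule blockvec_cong, goal_cases)
  case 1
  show ?case using assms by (subst sum_first_three) (auto simp: algebra_simps)
next
  case (2 i)
  then show ?case using assms by (subst sum_tridiagonal[where i = i]) (auto simp: of_nat_diff add.commute)
next
  case (3 i)
  then show ?case using assms by (subst sum_tridiagonal[where i = i]) (auto simp: of_nat_diff add.commute)
qed

section \<open>Eigenvectors of the system matrix\<close>

definition wave_mat :: "nat \<Rightarrow> real \<Rightarrow> real \<Rightarrow> real \<Rightarrow> real \<Rightarrow> real \<Rightarrow> real \<Rightarrow> real \<Rightarrow> real \<Rightarrow> real mat" where
  "wave_mat N g h u v a b c s = c \<cdot>\<^sub>m A_G N g h u v a b + s \<cdot>\<^sub>m B_G N g h u v a b"

lemma A_G_carrier: "A_G N g h u v a b \<in> carrier_mat (2 * N + 3) (2 * N + 3)"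
  and B_G_carrier: "B_G N g h u v a b \<in> carrier_mat (2 * N + 3) (2 * N + 3)"
  by (simp_all add: A_G_def B_G_def)

lemma wave_mat_carrier: "wave_mat N g h u v a b c s \<in> carrier_mat (2 * N + 3) (2 * N + 3)"
  using A_G_carrier B_G_carrier by (auto simp: wave_mat_def)

lemma lincomb_mult_vec:
  fixes A B :: "real mat"
  assumes "A \<in> carrier_mat m n" "B \<in> carrier_mat m n" "w \<in> carrier_vec n"
  shows "(c \<cdot>\<^sub>m A + s \<cdot>\<^sub>m B) *\<^sub>v w = c \<cdot>\<^sub>v (A *\<^sub>v w) + s \<cdot>\<^sub>v (B *\<^sub>v w)"
  using assms by (subst add_mult_distrib_mat_vec[of _ m n]) auto

lemma wave_mat_mult:
  "wave_mat N g h u v a b c s *\<^sub>v blockvec N t X Y =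
     c \<cdot>\<^sub>v (A_G N g h u v a b *\<^sub>v blockvec N t X Y) + s \<cdot>\<^sub>v (B_G N g h u v a b *\<^sub>v blockvec N t X Y)"
  unfolding wave_mat_def by (rule lincomb_mult_vec[OF A_G_carrier B_G_carrier blockvec_carrier])

lemma transpose_wave_mat_mult:
  "transpose_mat (wave_mat N g h u v a b c s) *\<^sub>v blockvec N t X Y =
     c \<cdot>\<^sub>v (transpose_mat (A_G N g h u v a b) *\<^sub>v blockvec N t X Y)
     + s \<cdot>\<^sub>v (transpose_mat (B_G N g h u v a b) *\<^sub>v blockvec N t X Y)"
proof -
  have "transpose_mat (wave_mat N g h u v a b c s) =
      c \<cdot>\<^sub>m transpose_mat (A_G N g h u v a b) + s \<cdot>\<^sub>m transpose_mat (B_G N g h u v a b)"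
    unfolding wave_mat_def using A_G_carrier[of N g h u v a b] B_G_carrier[of N g h u v a b]
    by (intro eq_matI) auto
  then show ?thesis
    using lincomb_mult_vec[OF transpose_carrier_mat[THEN iffD2, OF A_G_carrier]
      transpose_carrier_mat[THEN iffD2, OF B_G_carrier] blockvec_carrier] by simp
qed

text \<open>Generic block row: the matrices differ only in their velocity and moment factors, which
  combine into the directional ones. The scale \<open>t\<close> is later \<open>- s\<close> or
  \<open>c\<close>.\<close>

lemma direction_comb:
  fixes x :: real
  assumes "P * z + Q * z'' = x * z'"
  shows "c * (P * a * (t * z) + u * (t * z') + Q * a * (t * z''))
       + s * (P * b * (t * z) + v * (t * z') + Q * b * (t * z''))
       = (c * u + s * v + (c * a + s * b) * x) * (t * z')"
proof -
  have "c * (P * a * (t * z) + u * (t * z') + Q * a * (t * z''))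
       + s * (P * b * (t * z) + v * (t * z') + Q * b * (t * z''))
       = t * ((c * u + s * v) * z' + (c * a + s * b) * (P * z + Q * z''))"
    by (simp add: algebra_simps)
  then show ?thesis unfolding assms by (simp add: algebra_simps)
qed

text \<open>All blocks are multiples of (-s, c), orthogonal to the direction, so the scalar row
  gives 0. On such vectors block (1, 0) acts as \<open>c * a + s * b\<close> times the identity,
  whence the coefficient 1 of \<open>z 0\<close> in the equation for \<open>z 1\<close>.\<close>

lemma transverse_eigenvector:
  assumes z: "z (Suc N) = 0" "2 / 3 * z 1 = x * z 0" "z 0 + 3 / 5 * z 2 = x * z 1"
    "\<And>i. 2 \<le> i \<Longrightarrow> (real i - 1) / (2 * real i - 1) * z (i - 1) + (real i + 2) / (2 * real i + 3) * z (Suc i) = x * z i"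
  shows "wave_mat N g h u v a b c s *\<^sub>v blockvec N 0 (\<lambda>i. - s * z i) (\<lambda>i. c * z i) =
    (c * u + s * v + (c * a + s * b) * x) \<cdot>\<^sub>v blockvec N 0 (\<lambda>i. - s * z i) (\<lambda>i. c * z i)"
proof -
  have z1: "z 1 = 3 / 2 * (x * z 0)" and z2: "z 2 = 5 / 3 * (x * z 1 - z 0)" using z(2,3) by auto
  have X0: "- s * z (Suc N) = 0" "c * z (Suc N) = 0" using z by auto
  show ?thesis
    unfolding wave_mat_mult A_G_mult_blockvec[where X = "\<lambda>i. - s * z i" and Y = "\<lambda>i. c * z i", OF X0]
      B_G_mult_blockvec[where X = "\<lambda>i. - s * z i" and Y = "\<lambda>i. c * z i", OF X0] add_blockvec smult_blockvec
  proof (rule blockvec_cong, goal_cases)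
    case (2 i)
    show ?case
    proof (cases "i \<le> 1")
      case True
      then have "i = 0 \<or> i = 1" by auto
      then show ?thesis by (elim disjE) (simp_all add: z1[unfolded One_nat_def] z2 field_simps)
    next
      case False
      then show ?thesis using direction_comb[OF z(4)[of i], of c a "- s" u s b v] by simp
    qed
  next
    case (3 i)
    show ?case
    proof (cases "i \<le> 1")
      case True
      then have "i = 0 \<or> i = 1" by auto
      then show ?thesis by (elim disjE) (simp_all add: z1[unfolded One_nat_def] z2 field_simps)
    next
      case False
      then show ?thesis using direction_comb[OF z(4)[of i], of c a c u s b v] by simp
    qed
  qed simp
qed

text \<open>With respect to the variables \<open>h\<close>, \<open>w\<close>, \<open>r\<^sub>i\<close> this functional is
  \<open>y\<^sub>0 (w + k h) + (\<Sum>i\<ge>1. y\<^sub>i r\<^sub>i)\<close>. It covers the \<open>N\<close> eigenvalues with \<open>y\<^sub>0 = 0\<close> as well as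
  the pair \<open>k\<^sup>2 = g h + \<alpha>\<^sup>2\<close> with \<open>y\<^sub>0 = 1\<close>.\<close>
lemma normal_left_eigenvector:
  assumes N: "1 \<le> N" and cs: "c\<^sup>2 + s\<^sup>2 = 1" and al: "al = c * a + s * b"
    and y: "y (Suc N) = 0"
    "\<And>j. 1 \<le> j \<Longrightarrow> (real j + 1) / (2 * real j + 1) * al * y (j - 1) + real j / (2 * real j + 1) * al * y (Suc j) = k * y j"
    and k: "k\<^sup>2 * y 0 = (g * h + al\<^sup>2) * y 0"
  shows "transpose_mat (wave_mat N g h u v a b c s) *\<^sub>v
      blockvec N ((k - (c * u + s * v)) * y 0 - 2 * al * y 1) (\<lambda>i. c * y i) (\<lambda>i. s * y i) =
    (c * u + s * v + k) \<cdot>\<^sub>v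
      blockvec N ((k - (c * u + s * v)) * y 0 - 2 * al * y 1) (\<lambda>i. c * y i) (\<lambda>i. s * y i)"
proof -
  have y0: "c * y (Suc N) = 0" "s * y (Suc N) = 0" using y by auto
  define U where "U = c * u + s * v"
  \<comment> \<open>The recurrence at \<open>j = 1\<close>, used to eliminate \<open>y 2\<close>
    from the scalar component.\<close>
  have y1: "al * y 2 = 3 * k * y 1 - 2 * al * y 0"
    using y(2)[of 1] by (simp add: numeral_2_eq_2)
  have yj: "c * ((real j + 1) / (2 * real j + 1) * a * (t * y (j - 1)) + u * (t * y j) + real j / (2 * real j + 1) * a * (t * y (Suc j)))
      + s * ((real j + 1) / (2 * real j + 1) * b * (t * y (j - 1)) + v * (t * y j) + real j / (2 * real j + 1) * b * (t * y (Suc j)))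
      = (U + k) * (t * y j)" if "1 \<le> j" for j t
  proof -
    define P Q where "P = (real j + 1) / (2 * real j + 1)" and "Q = real j / (2 * real j + 1)"
    have "c * (P * a * (t * y (j - 1)) + u * (t * y j) + Q * a * (t * y (Suc j)))
      + s * (P * b * (t * y (j - 1)) + v * (t * y j) + Q * b * (t * y (Suc j)))
      = t * (U * y j + (P * al * y (j - 1) + Q * al * y (Suc j)))"
      by (simp add: al U_def algebra_simps)
    also have "P * al * y (j - 1) + Q * al * y (Suc j) = k * y j"
      using y(2)[OF that] by (simp add: P_def Q_def)
    finally show ?thesis by (simp add: P_def Q_def algebra_simps)
  qed
  show ?thesis
    unfolding transpose_wave_mat_mult transpose_A_G_mult_blockvec[where X = "\<lambda>i. c * y i" and Y = "\<lambda>i. s * y i", OF N y0]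
      transpose_B_G_mult_blockvec[where X = "\<lambda>i. c * y i" and Y = "\<lambda>i. s * y i", OF N y0] add_blockvec smult_blockvec U_def[symmetric]
  proof (rule blockvec_cong, goal_cases)
    case 1
    \<comment> \<open>The scalar component is the only one that involves \<open>g * h\<close>; here
      the condition on \<open>k\<close> enters and yields the factor \<open>U + k\<close>.\<close>
    have "c * ((- u\<^sup>2 - a\<^sup>2 / 3 + g * h) * (c * y 0) + (- u * v - a * b / 3) * (s * y 0)
        - 2 * u * a * (c * y 1) - (u * b + v * a) * (s * y 1) - 2 / 3 * a\<^sup>2 * (c * y 2) - 2 / 3 * a * b * (s * y 2))
      + s * ((- u * v - a * b / 3) * (c * y 0) + (- v\<^sup>2 - b\<^sup>2 / 3 + g * h) * (s * y 0)
        - (u * b + v * a) * (c * y 1) - 2 * v * b * (s * y 1) - 2 / 3 * a * b * (c * y 2) - 2 / 3 * b\<^sup>2 * (s * y 2))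
      = (- U\<^sup>2 - al\<^sup>2 / 3 + (c\<^sup>2 + s\<^sup>2) * (g * h)) * y 0 - 2 * U * al * y 1 - 2 / 3 * al * (al * y 2)"
      by (simp add: U_def al power2_eq_square field_simps)
    also have "\<dots> = (g * h + al\<^sup>2) * y 0 - U\<^sup>2 * y 0 - 2 * U * al * y 1 - 2 * al * k * y 1"
      unfolding cs y1 by (simp add: power2_eq_square algebra_simps)
    also have "\<dots> = (U + k) * ((k - U) * y 0 - 2 * al * y 1)"
      unfolding k[symmetric] by (simp add: power2_eq_square algebra_simps)
    finally show ?case .
  next
    case (2 j)
    show ?case
    proof (cases "j = 0")
      case True
      then show ?thesis by (simp add: U_def al algebra_simps)
    next
      case False
      then show ?thesis using yj[of j c] by simp
    qed
  next
    case (3 j)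
    show ?case
    proof (cases "j = 0")
      case True
      then show ?thesis by (simp add: U_def al algebra_simps)
    next
      case False
      then show ?thesis using yj[of j s] by simp
    qed
  qed
qed

text \<open>Since the directional moment vanishes, so do the tridiagonal couplings, and only the
  conditions on block 0 remain. The value of \<open>t\<close> cancels the terms there that are not
  multiples of \<open>c * u + s * v\<close>.\<close>

lemma degenerate_left_eigenvector:
  assumes N: "1 \<le> N" and al: "c * a + s * b = 0"
    and X: "X (Suc N) = 0" "Y (Suc N) = 0"
    and n: "c * X 0 + s * Y 0 = 0"
    and t: "t = - (u * X 0 + v * Y 0 + a * X 1 + b * Y 1)"
  shows "transpose_mat (wave_mat N g h u v a b c s) *\<^sub>v blockvec N t X Y =
    (c * u + s * v) \<cdot>\<^sub>v blockvec N t X Y"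
proof -
  have yj: "c * (P * a * z + u * z' + Q * a * z'') + s * (P * b * z + v * z' + Q * b * z'')
      = (c * u + s * v) * z'" for P Q z z' z'' :: real
  proof -
    have "c * (P * a * z + u * z' + Q * a * z'') + s * (P * b * z + v * z' + Q * b * z'')
        = (c * u + s * v) * z' + (c * a + s * b) * (P * z + Q * z'')" by (simp add: algebra_simps)
    then show ?thesis using al by simp
  qed
  show ?thesis
    unfolding transpose_wave_mat_mult transpose_A_G_mult_blockvec[where X = X and Y = Y, OF N X]
      transpose_B_G_mult_blockvec[where X = X and Y = Y, OF N X] add_blockvec smult_blockvec
  proof (rule blockvec_cong, goal_cases)
    case 1
    have "c * ((- u\<^sup>2 - a\<^sup>2 / 3 + g * h) * X 0 + (- u * v - a * b / 3) * Y 0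
        - 2 * u * a * X 1 - (u * b + v * a) * Y 1 - 2 / 3 * a\<^sup>2 * X 2 - 2 / 3 * a * b * Y 2)
      + s * ((- u * v - a * b / 3) * X 0 + (- v\<^sup>2 - b\<^sup>2 / 3 + g * h) * Y 0
        - (u * b + v * a) * X 1 - 2 * v * b * Y 1 - 2 / 3 * a * b * X 2 - 2 / 3 * b\<^sup>2 * Y 2)
      = - (c * u + s * v) * (u * X 0 + v * Y 0 + a * X 1 + b * Y 1) + g * h * (c * X 0 + s * Y 0)
        - (c * a + s * b) * ((a * X 0 + b * Y 0) / 3 + u * X 1 + v * Y 1 + 2 / 3 * (a * X 2 + b * Y 2))"
      by (simp add: power2_eq_square field_simps)
    also have "\<dots> = (c * u + s * v) * t"
      unfolding al n t by (simp only: mult_zero_left mult_zero_right add_0_right diff_zero mult_minus_left mult_minus_right)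
    finally show ?case .
  next
    case (2 j)
    show ?case
    proof (cases "j = 0")
      case True
      have "c * (t + 2 * u * X 0 + v * Y 0 + 2 * a * X 1 + b * Y 1) + s * (v * X 0 + b * X 1)
        = c * (t + (u * X 0 + v * Y 0 + a * X 1 + b * Y 1)) + (c * u + s * v) * X 0 + (c * a + s * b) * X 1"
        by (simp add: algebra_simps)
      then show ?thesis using True unfolding al t by simp
    next
      case False
      then show ?thesis by (simp only: if_False yj)
    qed
  next
    case (3 j)
    show ?case
    proof (cases "j = 0")
      case True
      have "c * (u * Y 0 + a * Y 1) + s * (t + u * X 0 + 2 * v * Y 0 + a * X 1 + 2 * b * Y 1)
        = s * (t + (u * X 0 + v * Y 0 + a * X 1 + b * Y 1)) + (c * u + s * v) * Y 0 + (c * a + s * b) * Y 1"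
        by (simp add: algebra_simps)
      then show ?thesis using True unfolding al t by simp
    next
      case False
      then show ?thesis by (simp only: if_False yj)
    qed
  qed
qed

section \<open>Diagonalizability of the system matrix\<close>

lemma root_char_polyI:
  fixes M :: "real mat"
  assumes "M \<in> carrier_mat n n" "w \<in> carrier_vec n" "M *\<^sub>v w = k \<cdot>\<^sub>v w" "i < n" "w $ i \<noteq> 0"
  shows "poly (char_poly M) k = 0"
  using assms by (subst eigenvalue_root_char_poly[symmetric, of _ n])
    (auto simp: eigenvalue_def eigenvector_def)

lemma root_char_poly_leftI:
  fixes M :: "real mat"
  assumes "M \<in> carrier_mat n n" "w \<in> carrier_vec n" "transpose_mat M *\<^sub>v w = k \<cdot>\<^sub>v w" "i < n" "w $ i \<noteq> 0"
  shows "poly (char_poly M) k = 0"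
  using root_char_polyI[of "transpose_mat M"] assms by (simp add: char_poly_transpose_mat[OF assms(1)])

lemma blockvec_nonzero:
  assumes "j \<le> N" "X j \<noteq> 0 \<or> Y j \<noteq> 0"
  shows "\<exists>k < 2 * N + 3. blockvec N t X Y $ k \<noteq> 0"
proof (cases "X j = 0")
  case False
  then show ?thesis using assms(1) by (intro exI[of _ "Suc (2 * j)"]) auto
next
  case True
  then show ?thesis using assms by (intro exI[of _ "Suc (Suc (2 * j))"]) auto
qed

text \<open>The recurrence solved for \<open>x\<close> times its middle term is a row of the
  transposed tridiagonal block. Keeping \<open>al\<close> as a factor avoids dividing by it.\<close>

lemma legendre_rec_row:
  assumes "1 \<le> j"
  shows "(real j + 1) / (2 * real j + 1) * al * poly (legendre_rec p q (j - 1)) x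
    + real j / (2 * real j + 1) * al * poly (legendre_rec p q (Suc j)) x = al * x * poly (legendre_rec p q j) x"
proof -
  obtain n where j: "j = Suc n" using assms by (cases j) auto
  define f where "f i = poly (legendre_rec p q i) x" for i
  have "(real n + 1) * f (Suc (Suc n)) = (2 * real n + 3) * (x * f (Suc n)) - (real n + 2) * f n"
    using poly_legendre_rec[of n p q x] by (simp only: f_def)
  then have e: "real j * f (Suc j) = (2 * real j + 1) * (x * f j) - (real j + 1) * f (j - 1)"
    by (simp add: j algebra_simps)
  have "(real j + 1) / (2 * real j + 1) * al * f (j - 1) + real j / (2 * real j + 1) * al * f (Suc j)
      = al * ((real j + 1) * f (j - 1) + real j * f (Suc j)) / (2 * real j + 1)"
    by (simp add: add_divide_distrib algebra_simps)
  also have "\<dots> = al * x * f j"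
    unfolding e by simp
  finally show ?thesis unfolding f_def .
qed

lemma transverse_root:
  assumes cs: "c\<^sup>2 + s\<^sup>2 = 1" and x: "poly (leg0 (Suc N)) x = 0"
  shows "poly (char_poly (wave_mat N g h u v a b c s)) (c * u + s * v + (c * a + s * b) * x) = 0"
proof -
  \<comment> \<open>The factor (2i+1)/(i(i+1)) is the diagonal scaling that turns the row
    coefficients of \<open>transverse_eigenvector\<close> into those of the recurrence divided by
    i(i+1). It is undefined at 0, where the value 1 fits and also makes the vector nonzero.\<close>
  define z where "z i = (if i = 0 then 1 else (2 * real i + 1) / (real i * (real i + 1)) * poly (leg0 i) x)" for i
  have "z (Suc N) = 0" by (simp add: z_def x del: legendre_rec.simps)
  moreover have "2 / 3 * z 1 = x * z 0" by (simp add: z_def)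
  moreover have "z 0 + 3 / 5 * z 2 = x * z 1" by (simp add: z_def numeral_2_eq_2 field_simps)
  moreover have "(real i - 1) / (2 * real i - 1) * z (i - 1) + (real i + 2) / (2 * real i + 3) * z (Suc i) = x * z i"
    if i: "2 \<le> i" for i
  proof -
    define f where "f i = poly (leg0 i) x" for i
    have pos: "real i > 0" "real i + 1 > 0" "real i - 1 > 0" "2 * real i - 1 > 0" "2 * real i + 1 > 0" using i by auto
    have "(real i - 1) / (2 * real i - 1) * z (i - 1) = f (i - 1) / real i"
      using i pos by (simp add: z_def f_def of_nat_diff)
    moreover have "(real i + 2) / (2 * real i + 3) * z (Suc i) = f (Suc i) / (real i + 1)"
    proof -
      have "z (Suc i) = (2 * real i + 3) / ((real i + 1) * (real i + 2)) * f (Suc i)"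
        by (simp add: z_def f_def algebra_simps del: legendre_rec.simps)
      moreover have "real i + 2 \<noteq> 0" "2 * real i + 3 \<noteq> 0" by linarith+
      ultimately show ?thesis by simp
    qed
    moreover have "f (i - 1) / real i + f (Suc i) / (real i + 1) = x * z i"
    proof -
      have "(real i + 1) / (2 * real i + 1) * 1 * f (i - 1) + real i / (2 * real i + 1) * 1 * f (Suc i) = 1 * x * f i"
        using legendre_rec_row[of i 1 1 "[:0, 1:]" x] i by (simp add: f_def)
      then have "((real i + 1) * f (i - 1) + real i * f (Suc i)) / (2 * real i + 1) = x * f i"
        by (simp add: add_divide_distrib[of "_ * _"])
      then have "(real i + 1) * f (i - 1) + real i * f (Suc i) = x * f i * (2 * real i + 1)"
        using pos by (simp add: divide_eq_eq)
      then have "((real i + 1) * f (i - 1) + real i * f (Suc i)) / (real i * (real i + 1))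
          = x * f i * (2 * real i + 1) / (real i * (real i + 1))" by simp
      moreover have "((real i + 1) * f (i - 1) + real i * f (Suc i)) / (real i * (real i + 1))
          = f (i - 1) / real i + f (Suc i) / (real i + 1)"
        using pos by (simp add: add_divide_distrib)
      ultimately show ?thesis
        using i by (simp add: z_def f_def[symmetric] mult_ac)
    qed
    ultimately show ?thesis by simp
  qed
  ultimately have ev: "wave_mat N g h u v a b c s *\<^sub>v blockvec N 0 (\<lambda>i. - s * z i) (\<lambda>i. c * z i) =
    (c * u + s * v + (c * a + s * b) * x) \<cdot>\<^sub>v blockvec N 0 (\<lambda>i. - s * z i) (\<lambda>i. c * z i)"
    by (rule transverse_eigenvector)
  have "- s * z 0 \<noteq> 0 \<or> c * z 0 \<noteq> 0" using cs by (auto simp: z_def)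
  then obtain k where "k < 2 * N + 3" "blockvec N 0 (\<lambda>i. - s * z i) (\<lambda>i. c * z i) $ k \<noteq> 0"
    using blockvec_nonzero[of 0 N "\<lambda>i. - s * z i" "\<lambda>i. c * z i"] by blast
  then show ?thesis
    using root_char_polyI[OF wave_mat_carrier blockvec_carrier ev] by blast
qed

lemma normal_root:
  assumes N: "1 \<le> N" and cs: "c\<^sup>2 + s\<^sup>2 = 1"
    and y: "y (Suc N) = 0"
    "\<And>j. 1 \<le> j \<Longrightarrow> (real j + 1) / (2 * real j + 1) * (c * a + s * b) * y (j - 1)
      + real j / (2 * real j + 1) * (c * a + s * b) * y (Suc j) = k * y j"
    and k: "k\<^sup>2 * y 0 = (g * h + (c * a + s * b)\<^sup>2) * y 0"
    and nz: "j \<le> N" "y j \<noteq> 0"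
  shows "poly (char_poly (wave_mat N g h u v a b c s)) (c * u + s * v + k) = 0"
proof -
  have "c * y j \<noteq> 0 \<or> s * y j \<noteq> 0" using cs nz by auto
  then obtain l where "l < 2 * N + 3"
    "blockvec N ((k - (c * u + s * v)) * y 0 - 2 * (c * a + s * b) * y 1) (\<lambda>i. c * y i) (\<lambda>i. s * y i) $ l \<noteq> 0"
    using blockvec_nonzero[of j N "\<lambda>i. c * y i" "\<lambda>i. s * y i"] nz by blast
  then show ?thesis
    using root_char_poly_leftI[OF wave_mat_carrier blockvec_carrier normal_left_eigenvector[OF N cs refl y k]]
    by blast
qed

text \<open>As \<open>leg1 0 = 0\<close>, the condition on \<open>k\<close> in
  \<open>normal_root\<close> reads 0 = 0; the vector is nonzero because
  \<open>leg1 1 = 1\<close>.\<close>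

lemma shear_root:
  assumes N: "1 \<le> N" and cs: "c\<^sup>2 + s\<^sup>2 = 1" and x: "poly (leg1 (Suc N)) x = 0"
  shows "poly (char_poly (wave_mat N g h u v a b c s)) (c * u + s * v + (c * a + s * b) * x) = 0"
  by (rule normal_root[where y = "\<lambda>j. poly (leg1 j) x" and j = 1, OF N cs])
    (use x N legendre_rec_row[where al = "c * a + s * b"] in auto)

text \<open>Here \<open>y 0 = 1\<close>, so \<open>k\<close> is prescribed and the recurrence must
  be closed at \<open>N + 1\<close> for \<open>x = k / al\<close>. This succeeds because
  \<open>x\<close> lies outside (-1, 1), where \<open>leg1 (Suc N)\<close> has no roots.\<close>

lemma acoustic_root:
  assumes N: "1 \<le> N" and cs: "c\<^sup>2 + s\<^sup>2 = 1" and al: "c * a + s * b \<noteq> 0"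
    and G: "g * h > 0" and k: "k\<^sup>2 = g * h + (c * a + s * b)\<^sup>2"
  shows "poly (char_poly (wave_mat N g h u v a b c s)) (c * u + s * v + k) = 0"
proof -
  define al where "al = c * a + s * b"
  define x where "x = k / al"
  have al0: "al \<noteq> 0" using al by (simp add: al_def)
  have kx: "k = al * x" using al0 by (simp add: x_def)
  have "al\<^sup>2 < k\<^sup>2" using k G by (simp add: al_def)
  then have "1 < x\<^sup>2" using al0 by (simp add: x_def power_divide)
  then have "\<not> (- 1 < x \<and> x < 1)" using abs_square_less_1[of x] by auto
  then have S: "poly (leg1 (Suc N)) x \<noteq> 0"
    using leg1.roots_in_unit_interval(1)[of N] by auto
  \<comment> \<open>The free value \<open>y 1\<close> of the recurrence is chosen so that \<open>y (Suc N) = 0\<close>.\<close>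
  define t where "t = - poly (leg0 (Suc N)) x / poly (leg1 (Suc N)) x"
  define y where "y j = poly (leg0 j) x + t * poly (leg1 j) x" for j
  show ?thesis
  proof (rule normal_root[where y = y and j = 0 and a = a and b = b, OF N cs, folded al_def])
    show "y (Suc N) = 0" using S unfolding y_def t_def by simp
    show "k\<^sup>2 * y 0 = (g * h + al\<^sup>2) * y 0" using k by (simp add: al_def)
    show "y 0 \<noteq> 0" by (simp add: y_def)
    fix j :: nat assume j: "1 \<le> j"
    let ?P = "(real j + 1) / (2 * real j + 1) * al" and ?Q = "real j / (2 * real j + 1) * al"
    have "?P * y (j - 1) + ?Q * y (Suc j)
      = (?P * poly (leg0 (j - 1)) x + ?Q * poly (leg0 (Suc j)) x)
        + t * (?P * poly (leg1 (j - 1)) x + ?Q * poly (leg1 (Suc j)) x)"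
      unfolding y_def by (simp only: distrib_left) (simp only: ac_simps)
    also have "\<dots> = k * y j"
      unfolding legendre_rec_row[OF j] by (simp only: y_def kx) (simp only: ac_simps distrib_left)
    finally show "?P * y (j - 1) + ?Q * y (Suc j) = k * y j" .
  qed simp
qed

text \<open>There are N+1 transverse, N shear and 2 acoustic eigenvalues. The first two families are
  disjoint by \<open>no_common_root\<close> and lie within \<open>\<bar>al\<bar>\<close> of
  \<open>U\<close>, while the acoustic pair is at the larger distance \<open>k\<close>.\<close>

lemma diagonalizable_nondegenerate:
  assumes N: "1 \<le> N" and cs: "c\<^sup>2 + s\<^sup>2 = 1" and al: "c * a + s * b \<noteq> 0" and G: "g * h > 0"
  shows "diagonalizable_mat (wave_mat N g h u v a b c s)"
proof -
  define al where "al = c * a + s * b"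
  define U where "U = c * u + s * v"
  define k where "k = sqrt (g * h + al\<^sup>2)"
  define R where "R = {x. poly (leg0 (Suc N)) x = 0}"
  define S where "S = {x. poly (leg1 (Suc N)) x = 0}"
  define f where "f x = U + al * x" for x
  have al0: "al \<noteq> 0" using al by (simp add: al_def)
  have inj: "inj_on f A" for A using al0 by (auto simp: inj_on_def f_def)
  have R: "card R = Suc N" "R \<subseteq> {-1<..<1}" and S: "card S = N" "S \<subseteq> {-1<..<1}"
    using leg0.roots_in_unit_interval[of "Suc N"] leg1.roots_in_unit_interval[of N] by (auto simp: R_def S_def)
  have fin: "finite R" "finite S"
    using R S N by (auto intro: card_ge_0_finite)
  have disj: "R \<inter> S = {}"
    using no_common_root by (auto simp: R_def S_def simp del: legendre_rec.simps)
  have k: "k\<^sup>2 = g * h + al\<^sup>2" "k > 0"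
    using G by (auto simp: k_def add_pos_nonneg)
  have kal: "\<bar>al\<bar> < k"
    unfolding k_def using G by (intro real_less_rsqrt) simp
  have bound: "\<bar>f x - U\<bar> < k" if "x \<in> R \<union> S" for x
  proof -
    have "x \<in> {-1<..<1}" using that R S by blast
    then have "\<bar>x\<bar> \<le> 1" by auto
    then have "\<bar>al * x\<bar> \<le> \<bar>al\<bar>" by (simp add: abs_mult mult_left_le)
    then show ?thesis using kal by (simp add: f_def)
  qed
  define T where "T = f ` (R \<union> S) \<union> {U + k, U - k}"
  have "card (f ` (R \<union> S)) = 2 * N + 1"
    using R S fin disj by (simp add: card_image[OF inj] card_Un_disjoint)
  moreover have "f ` (R \<union> S) \<inter> {U + k, U - k} = {}"
    using bound k(2) by fastforce
  then have "card T = card (f ` (R \<union> S)) + card {U + k, U - k}"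
    unfolding T_def using fin by (intro card_Un_disjoint) auto
  moreover have "card {U + k, U - k} = 2" using k(2) by (simp add: card_insert_if)
  ultimately have card: "card T = 2 * N + 3" by simp
  have "poly (char_poly (wave_mat N g h u v a b c s)) x = 0" if "x \<in> T" for x
    using that transverse_root[OF cs] shear_root[OF N cs] acoustic_root[OF N cs al G, of k] acoustic_root[OF N cs al G, of "- k"] k
    by (auto simp: T_def f_def R_def S_def U_def al_def simp del: legendre_rec.simps)
  then show ?thesis
    using diagonalizable_mat_distinct_roots[OF wave_mat_carrier _ card] fin by (auto simp: T_def)
qed

text \<open>Now \<open>U\<close> is a repeated eigenvalue, so a left eigenbasis is given instead: 0
  and 1 index the acoustic pair, 2 the transverse direction in block 0, and each later
  \<open>k\<close> a unit vector corrected in the scalar component.\<close>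

lemma diagonalizable_degenerate:
  assumes N: "1 \<le> N" and cs: "c\<^sup>2 + s\<^sup>2 = 1" and al: "c * a + s * b = 0" and G: "g * h > 0"
  shows "diagonalizable_mat (wave_mat N g h u v a b c s)"
proof -
  define U where "U = c * u + s * v"
  define \<kappa> where "\<kappa> k = (if k = 0 then sqrt (g * h) else - sqrt (g * h))" for k :: nat
  define X where "X k i = (if k \<le> 1 then c * of_bool (i = 0) else if k = 2 then - s * of_bool (i = 0)
    else of_bool (k = Suc (2 * i)))" for k i :: nat
  define Y where "Y k i = (if k \<le> 1 then s * of_bool (i = 0) else if k = 2 then c * of_bool (i = 0)
    else of_bool (k = Suc (Suc (2 * i))))" for k i :: nat
  define t where "t k = (if k \<le> 1 then \<kappa> k - U
    else - (u * X k 0 + v * Y k 0 + a * X k 1 + b * Y k 1))" for k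
  define y where "y k = blockvec N (t k) (X k) (Y k)" for k
  define d where "d k = (if k \<le> 1 then U + \<kappa> k else U)" for k
  show ?thesis
  proof (rule diagonalizable_mat_left_eigenbasis[OF wave_mat_carrier, where y = y and d = d])
    show "y k \<in> carrier_vec (2 * N + 3)" for k by (simp add: y_def)
  next
    fix k assume k: "k < 2 * N + 3"
    show "transpose_mat (wave_mat N g h u v a b c s) *\<^sub>v y k = d k \<cdot>\<^sub>v y k"
    proof (cases "k \<le> 1")
      case True
      let ?y = "\<lambda>i::nat. of_bool (i = 0) :: real"
      have "y k = blockvec N ((\<kappa> k - (c * u + s * v)) * ?y 0 - 2 * 0 * ?y 1) (\<lambda>i. c * ?y i) (\<lambda>i. s * ?y i)"
        unfolding y_def by (rule blockvec_cong) (use True in \<open>simp_all add: t_def X_def Y_def U_def\<close>)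
      moreover have "\<kappa> k ^ 2 = g * h" using G by (simp add: \<kappa>_def)
      ultimately show ?thesis
        using normal_left_eigenvector[OF N cs al[symmetric], of ?y "\<kappa> k" g h u v] True
        by (simp add: d_def U_def)
    next
      case False
      \<comment> \<open>The bound on \<open>k\<close> keeps the unit vectors out of the absent block
        \<open>N + 1\<close>.\<close>
      have "k \<noteq> Suc (Suc (2 * Suc N))" "k \<noteq> Suc (2 * Suc N)" using k by auto
      then have "X k (Suc N) = 0" "Y k (Suc N) = 0" "c * X k 0 + s * Y k 0 = 0"
        using False by (auto simp: X_def Y_def)
      then show ?thesis
        using degenerate_left_eigenvector[OF N al, of "X k" "Y k" "t k" u v g h] False
        by (simp add: y_def d_def U_def t_def)
    qed
  next
    fix w :: "real vec" assume w: "w \<in> carrier_vec (2 * N + 3)" and orth: "\<And>k. k < 2 * N + 3 \<Longrightarrow> y k \<bullet> w = 0"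
    have sp: "t k * w $ 0 + (\<Sum>j\<le>N. X k j * w $ Suc (2 * j) + Y k j * w $ Suc (Suc (2 * j))) = 0"
      if "k < 2 * N + 3" for k
      using orth[OF that] unfolding y_def blockvec_scalar_prod[OF w] by simp
    have only0: "(\<Sum>j\<le>N. p * of_bool (j = 0) * w $ Suc (2 * j) + q * of_bool (j = 0) * w $ Suc (Suc (2 * j)))
        = p * w $ 1 + q * w $ 2" for p q
      by (subst sum.remove[of _ 0]) (auto simp: numeral_2_eq_2)
    have 0: "(sqrt (g * h) - U) * w $ 0 + (c * w $ 1 + s * w $ 2) = 0"
      using sp[of 0] by (simp add: t_def \<kappa>_def X_def Y_def only0)
    have 1: "(- sqrt (g * h) - U) * w $ 0 + (c * w $ 1 + s * w $ 2) = 0"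
      using sp[of 1] by (simp add: t_def \<kappa>_def X_def Y_def only0)
    \<comment> \<open>The difference of the two acoustic conditions isolates \<open>w $ 0\<close>,
      with a nonzero factor since \<open>g * h\<close> is positive.\<close>
    have "2 * sqrt (g * h) * w $ 0 = ((sqrt (g * h) - U) * w $ 0 + (c * w $ 1 + s * w $ 2))
        - ((- sqrt (g * h) - U) * w $ 0 + (c * w $ 1 + s * w $ 2))" by (simp add: algebra_simps)
    also have "\<dots> = 0" unfolding 0 1 by simp
    finally have w0: "w $ 0 = 0" using G by auto
    have e: "c * w $ 1 + s * w $ 2 = 0" using 0 w0 by simp
    have e': "- s * w $ 1 + c * w $ 2 = 0"
      using sp[of 2] by (simp add: w0 X_def Y_def only0 del: mult_minus_left)
    \<comment> \<open>\<open>e\<close> and \<open>e'\<close> are the components of block 0 in the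
      rotated frame; inverting the rotation recovers both entries.\<close>
    have "w $ 1 = (c\<^sup>2 + s\<^sup>2) * w $ 1" using cs by simp
    also have "\<dots> = c * (c * w $ 1 + s * w $ 2) - s * (- s * w $ 1 + c * w $ 2)"
      by (simp add: power2_eq_square algebra_simps)
    finally have w1: "w $ 1 = 0" using e e' by simp
    have "w $ 2 = (c\<^sup>2 + s\<^sup>2) * w $ 2" using cs by simp
    also have "\<dots> = s * (c * w $ 1 + s * w $ 2) + c * (- s * w $ 1 + c * w $ 2)"
      by (simp add: power2_eq_square algebra_simps)
    finally have w2: "w $ 2 = 0" using e e' by simp
    have wk: "w $ k = 0" if k: "3 \<le> k" "k < 2 * N + 3" for k
    proof -
      \<comment> \<open>As \<open>w $ 0 = 0\<close>, the scalar correction drops out and the pairing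
        with \<open>y k\<close> is just \<open>w $ k\<close>.\<close>
      have *: "(\<Sum>j\<le>N. of_bool (k = Suc (2 * j)) * w $ Suc (2 * j) + of_bool (k = Suc (Suc (2 * j))) * w $ Suc (Suc (2 * j))) = 0"
        using sp[OF k(2)] k(1) by (simp add: w0 X_def Y_def)
      show ?thesis
        using k(2)
      proof (cases rule: block_index_cases)
        case (2 m)
        then have "(\<Sum>j\<le>N. of_bool (k = Suc (2 * j)) * w $ Suc (2 * j) + of_bool (k = Suc (Suc (2 * j))) * w $ Suc (Suc (2 * j)))
          = (\<Sum>j\<le>N. if j = m then w $ k else 0)"
          by (intro sum.cong) (auto simp: double_not_eq_Suc_double Suc_double_not_eq_double)
        then show ?thesis using * 2 by simp
      next
        case (3 m)
        then have "(\<Sum>j\<le>N. of_bool (k = Suc (2 * j)) * w $ Suc (2 * j) + of_bool (k = Suc (Suc (2 * j))) * w $ Suc (Suc (2 * j)))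
          = (\<Sum>j\<le>N. if j = m then w $ k else 0)"
          by (intro sum.cong) (auto simp: double_not_eq_Suc_double Suc_double_not_eq_double)
        then show ?thesis using * 3 by simp
      qed (use k in simp)
    qed
    show "w = 0\<^sub>v (2 * N + 3)"
    proof (rule eq_vecI)
      fix k assume "k < dim_vec (0\<^sub>v (2 * N + 3) :: real vec)"
      then have k: "k < 2 * N + 3" by simp
      consider "k = 0" | "k = 1" | "k = 2" | "3 \<le> k" by linarith
      then show "w $ k = 0\<^sub>v (2 * N + 3) $ k"
        using w0 w1 w2 wk k by cases auto
    qed (use w in simp)
  qed
qed

theorem theorem4p7:
  fixes N :: nat and g h u_m v_m \<alpha>\<^sub>1 \<beta>\<^sub>1 \<theta> :: real
  assumes "1 \<le> N" and "N \<le> 100" and "g > 0" and "h > 0"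
    and "\<theta> \<in> {0..<2 * pi}"
  shows "diagonalizable_mat
           (cos \<theta> \<cdot>\<^sub>m A_G N g h u_m v_m \<alpha>\<^sub>1 \<beta>\<^sub>1 + sin \<theta> \<cdot>\<^sub>m B_G N g h u_m v_m \<alpha>\<^sub>1 \<beta>\<^sub>1)"
proof -
  have G: "g * h > 0" using assms by simp
  have cs: "(cos \<theta>)\<^sup>2 + (sin \<theta>)\<^sup>2 = 1" by simp
  \<comment> \<open>The split is on whether the component of the first moment along the direction
    vanishes.\<close>
  show ?thesis
    using diagonalizable_nondegenerate[OF assms(1) cs _ G] diagonalizable_degenerate[OF assms(1) cs _ G]
    unfolding wave_mat_def by blast
qed

end
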